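(* Let $n,r\in\mathbb{N}$ and let $\mathcal{A}$ be any family of $r$-element subsets of $[n]=\{1,\dots,n\}$. Then \[ e(\mathcal{A})\ge \frac{\ell(\mathcal{A})^2}{2\binom{2r}{r}}. \]
   Context: For a family $\mathcal{A}$ of $r$-element subsets of $[n]$, $e(\mathcal{A})$ denotes the number of (unordered) pairs of disjoint sets in $\mathcal{A}$; equivalently, the number of edges in the subgraph induced by $\mathcal{A}$ in the Kneser graph $K(n,r)$ (the graph on the $r$-element subsets of $[n]$ in which two sets are adjacent if and only if they are disjoint). A family is intersecting if any two of its members have nonempty intersection. $\ell(\mathcal{A})=|\mathcal{A}|-|\mathcal{A}^*|$, where $\mathcal{A}^*$ is an intersecting subfamily of $\mathcal{A}$ of maximum cardinality. *)

theory Defs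
  imports Complex_Main "HOL-Library.Ramsey"
begin

text \<open>
  Disjoint pairs are unordered pairs of distinct members, i.e. edges of the (loopless) Kneser graph.
  Likewise ``any two members'' in the definition of an intersecting family means two distinct
  members. The distinctness only matters if the empty set belongs to the family, which for a family
  of $r$-element sets can happen only when $r = 0$.
\<close>

definition disjoint_pairs :: "'a set set \<Rightarrow> 'a set set set" where
  "disjoint_pairs \<A> = {{S, T} | S T. S \<in> \<A> \<and> T \<in> \<A> \<and> S \<noteq> T \<and> S \<inter> T = {}}"

definition num_disjoint_pairs :: "'a set set \<Rightarrow> nat" where
  "num_disjoint_pairs \<A> = card (disjoint_pairs \<A>)"

definition intersecting :: "'a set set \<Rightarrow> bool" where
  "intersecting \<A> \<longleftrightarrow> pairwise (\<lambda>S T. S \<inter> T \<noteq> {}) \<A>"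

text \<open>
  Meant for finite families: there the maximum ranges over a finite set, nonempty because
  the empty family is intersecting, and is at most \<open>card \<A>\<close>, so that the subtraction
  of natural numbers does not truncate.
\<close>

definition ell :: "'a set set \<Rightarrow> nat" where
  "ell \<A> = card \<A> - Max {card \<B> | \<B>. \<B> \<subseteq> \<A> \<and> intersecting \<B>}"

end

theory Submission
  imports Defs
begin

text \<open>
  Let \<open>C = (2 * r) choose r\<close>. Choose a minimal \<open>\<D> \<subseteq> \<A>\<close> whose members' neighbourhoods in
  the Kneser graph cover all non-isolated members of \<open>\<A>\<close>. By minimality every \<open>S \<in> \<D>\<close> has a
  private neighbour, and these pairs satisfy the hypotheses of Bollobas's set-pair
  inequality, so \<open>card \<D> \<le> C\<close>. Deleting the non-isolated members leaves an intersecting family;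
  hence some \<open>S \<in> \<D>\<close> has degree at least \<open>\<ell>(\<A>) / C\<close>. Removing \<open>S\<close> lowers \<open>\<ell>\<close> by at most one,
  so iterating gives \<open>C * e(\<A>) \<ge> 1 + 2 + \<dots> + \<ell>(\<A>)\<close>.
\<close>

section \<open>The set-pair inequality of Bollobas\<close>

text \<open>Deleting a point of a \<open>b\<close>-set scales the weight
  \<open>1 / ((a + b) choose a)\<close> by \<open>(a + b) / b\<close>, so the \<open>b\<close>
  possible deletions together contribute the factor \<open>a + b\<close>.\<close>

lemma inverse_binomial_step:
  fixes a b :: nat
  assumes "b > 0"
  shows "real b / real ((a + (b - 1)) choose a) = real (a + b) / real ((a + b) choose a)"
proof -
  obtain k where b: "b = Suc k"
    using assms gr0_conv_Suc by blast
  have "Suc (a + k) * ((a + k) choose a) = Suc k * (Suc (a + k) choose a)"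
    using Suc_times_binomial_add[of a k] Suc_times_binomial[of a "a + k"] by simp
  then have "real (Suc (a + k)) * real ((a + k) choose a)
      = real (Suc k) * real (Suc (a + k) choose a)"
    by (metis of_nat_mult)
  moreover have "real ((a + k) choose a) > 0" "real (Suc (a + k) choose a) > 0"
    by (simp_all del: binomial_Suc_Suc)
  ultimately show ?thesis
    by (simp add: b field_simps del: binomial_Suc_Suc of_nat_Suc)
qed

text \<open>
  Induction on the ground set: for each point \<open>x\<close>, apply the inequality on \<open>X - {x}\<close> to the
  pairs \<open>(A i, B i - {x})\<close> with \<open>x \<notin> A i\<close>. Summed over \<open>x\<close>, the weight of each
  pair is multiplied by exactly \<open>card X\<close>.
\<close>

theorem Bollobas_set_pairs:
  fixes A B :: "'i \<Rightarrow> 'a set"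
  assumes "finite I" "finite X"
    and "\<And>i. i \<in> I \<Longrightarrow> A i \<subseteq> X" "\<And>i. i \<in> I \<Longrightarrow> B i \<subseteq> X"
    and "\<And>i. i \<in> I \<Longrightarrow> A i \<inter> B i = {}"
    and "\<And>i j. i \<in> I \<Longrightarrow> j \<in> I \<Longrightarrow> i \<noteq> j \<Longrightarrow> A i \<inter> B j \<noteq> {}"
  shows "(\<Sum>i\<in>I. 1 / real ((card (A i) + card (B i)) choose card (A i))) \<le> 1"
  using assms
proof (induction "card X" arbitrary: X I B rule: less_induct)
  case less
  note fin = less.prems(1,2) and AX = less.prems(3) and BX = less.prems(4)
    and disj = less.prems(5) and cross = less.prems(6)
  let ?w = "\<lambda>a b. 1 / real ((a + b) choose a)"
  show ?case
  proof (cases "I = {} \<or> (\<exists>i\<in>I. B i = {})")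
    case True
    then show ?thesis
    proof
      \<comment> \<open>An empty \<open>B i\<close> meets no \<open>A j\<close>, so \<open>i\<close>
        is the only index. Outside this case \<open>card (B i) > 0\<close>, as
        \<open>inverse_binomial_step\<close> requires.\<close>
      assume "\<exists>i\<in>I. B i = {}"
      then obtain i where i: "i \<in> I" "B i = {}" by blast
      then have "I = {i}" using cross[of _ i] by blast
      then show ?thesis using i by simp
    qed simp
  next
    case False
    have finA: "finite (A i)" and finB: "finite (B i)" if "i \<in> I" for i
      using AX[OF that] BX[OF that] fin finite_subset by blast+
    have Xpos: "card X > 0"
      using False BX fin by (metis card_gt_0_iff ex_in_conv subset_empty)
    have step: "(\<Sum>i\<in>{i\<in>I. x \<notin> A i}. ?w (card (A i)) (card (B i - {x}))) \<le> 1"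
      if x: "x \<in> X" for x
    proof (rule less.hyps[of "X - {x}"])
      show "card (X - {x}) < card X" using fin(2) x by (rule card_Diff1_less)
      show "finite {i \<in> I. x \<notin> A i}" "finite (X - {x})" using fin by simp_all
      show "A i \<subseteq> X - {x}" if "i \<in> {i \<in> I. x \<notin> A i}" for i using that AX[of i] by auto
      show "B i - {x} \<subseteq> X - {x}" if "i \<in> {i \<in> I. x \<notin> A i}" for i using that BX[of i] by auto
      show "A i \<inter> (B i - {x}) = {}" if "i \<in> {i \<in> I. x \<notin> A i}" for i
        using that disj[of i] by auto
      \<comment> \<open>Since \<open>x\<close> is not in \<open>A i\<close>, deleting it from
        \<open>B j\<close> keeps all common points.\<close>
      show "A i \<inter> (B j - {x}) \<noteq> {}"
        if "i \<in> {i \<in> I. x \<notin> A i}" "j \<in> {i \<in> I. x \<notin> A i}" "i \<noteq> j" for i j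
        using that cross[of i j] by auto
    qed
    have weight: "(\<Sum>x\<in>X - A i. ?w (card (A i)) (card (B i - {x})))
        = real (card X) * ?w (card (A i)) (card (B i))" if i: "i \<in> I" for i
    proof -
      let ?a = "card (A i)" and ?b = "card (B i)" and ?R = "X - (A i \<union> B i)"
      \<comment> \<open>Points of \<open>?R\<close> leave the weight unchanged; points of
        \<open>B i\<close> contribute the factor \<open>?a + ?b\<close> in total.\<close>
      have split: "X - A i = ?R \<union> B i" "?R \<inter> B i = {}"
        using BX[OF i] disj[OF i] by auto
      have "(\<Sum>x\<in>X - A i. ?w ?a (card (B i - {x})))
          = (\<Sum>x\<in>?R. ?w ?a (card (B i - {x}))) + (\<Sum>x\<in>B i. ?w ?a (card (B i - {x})))"
        unfolding split(1) using split(2) fin(2) finB[OF i]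
        by (subst sum.union_disjoint) auto
      also have "(\<Sum>x\<in>?R. ?w ?a (card (B i - {x}))) = (\<Sum>x\<in>?R. ?w ?a ?b)"
        by (intro sum.cong) auto
      also have "\<dots> = real (card ?R) * ?w ?a ?b" by simp
      also have "(\<Sum>x\<in>B i. ?w ?a (card (B i - {x}))) = (\<Sum>x\<in>B i. ?w ?a (?b - 1))"
        by (intro sum.cong) (simp_all add: card_Diff_singleton)
      also have "\<dots> = real ?b / real ((?a + (?b - 1)) choose ?a)" by simp
      also have "\<dots> = real (?a + ?b) * ?w ?a ?b"
        using inverse_binomial_step[of ?b ?a] False i finB[OF i]
        by (simp add: card_gt_0_iff)
      also have "real (card ?R) * ?w ?a ?b + real (?a + ?b) * ?w ?a ?b
          = real (card ?R + (?a + ?b)) * ?w ?a ?b"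
        by (simp only: of_nat_add distrib_right)
      also have "card ?R + (?a + ?b) = card X"
      proof -
        have "card (?R \<union> (A i \<union> B i)) = card ?R + card (A i \<union> B i)"
          using fin finA[OF i] finB[OF i] by (intro card_Un_disjoint) auto
        moreover have "card (A i \<union> B i) = ?a + ?b"
          using finA[OF i] finB[OF i] disj[OF i] by (rule card_Un_disjoint)
        moreover have "?R \<union> (A i \<union> B i) = X" using AX[OF i] BX[OF i] by blast
        ultimately show ?thesis by simp
      qed
      finally show ?thesis .
    qed
    have "real (card X) * (\<Sum>i\<in>I. ?w (card (A i)) (card (B i)))
        = (\<Sum>i\<in>I. \<Sum>x\<in>{x\<in>X. x \<notin> A i}. ?w (card (A i)) (card (B i - {x})))"
      unfolding sum_distrib_left
      by (intro sum.cong refl) (simp only: weight[symmetric] set_diff_eq)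
    also have "\<dots> = (\<Sum>x\<in>X. \<Sum>i\<in>{i\<in>I. x \<notin> A i}. ?w (card (A i)) (card (B i - {x})))"
      using fin by (rule sum.swap_restrict)
    also have "\<dots> \<le> (\<Sum>x\<in>X. 1)" by (intro sum_mono step)
    finally have "real (card X) * (\<Sum>i\<in>I. ?w (card (A i)) (card (B i))) \<le> real (card X) * 1"
      by simp
    then show ?thesis using Xpos by simp
  qed
qed

corollary Bollobas_uniform:
  fixes A B :: "'i \<Rightarrow> 'a set"
  assumes "finite I" "finite X"
    and "\<And>i. i \<in> I \<Longrightarrow> A i \<in> nsets X a" "\<And>i. i \<in> I \<Longrightarrow> B i \<in> nsets X b"
    and "\<And>i. i \<in> I \<Longrightarrow> A i \<inter> B i = {}"
    and "\<And>i j. i \<in> I \<Longrightarrow> j \<in> I \<Longrightarrow> i \<noteq> j \<Longrightarrow> A i \<inter> B j \<noteq> {}"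
  shows "card I \<le> (a + b) choose a"
proof -
  have "(\<Sum>i\<in>I. 1 / real ((card (A i) + card (B i)) choose card (A i))) \<le> 1"
    using assms by (intro Bollobas_set_pairs[of I X]) (auto simp: nsets_def)
  moreover have "(\<Sum>i\<in>I. 1 / real ((card (A i) + card (B i)) choose card (A i)))
      = (\<Sum>i\<in>I. 1 / real ((a + b) choose a))"
    using assms(3,4) by (intro sum.cong) (auto simp: nsets_def)
  moreover have "real ((a + b) choose a) > 0" by simp
  ultimately show ?thesis by (simp add: field_simps)
qed

section \<open>Minimal covers\<close>

text \<open>In an inclusion-minimal subfamily with the same union, a member whose whole
  \<open>N S\<close> is covered by the others could be dropped. The private elements later serve as
  partners in the set-pair inequality.\<close>

lemma minimal_subcover:
  assumes "finite \<A>"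
  obtains \<D> where "\<D> \<subseteq> \<A>" "(\<Union>S\<in>\<D>. N S) = (\<Union>S\<in>\<A>. N S)"
    and "\<And>S. S \<in> \<D> \<Longrightarrow> \<exists>T\<in>N S. \<forall>S'\<in>\<D>. S' \<noteq> S \<longrightarrow> T \<notin> N S'"
proof -
  let ?K = "{\<D>. \<D> \<subseteq> \<A> \<and> (\<Union>S\<in>\<D>. N S) = (\<Union>S\<in>\<A>. N S)}"
  have "finite ?K"
    using assms by (intro finite_subset[of ?K "Pow \<A>"]) auto
  moreover have "?K \<noteq> {}" by blast
  ultimately obtain \<D> where \<D>: "\<D> \<in> ?K" and min: "\<forall>\<D>'\<in>?K. \<D>' \<subseteq> \<D> \<longrightarrow> \<D> = \<D>'"
    by (rule finite_has_minimal[THEN bexE])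
  show thesis
  proof
    show "\<D> \<subseteq> \<A>" "(\<Union>S\<in>\<D>. N S) = (\<Union>S\<in>\<A>. N S)"
      using \<D> by simp_all
    show "\<exists>T\<in>N S. \<forall>S'\<in>\<D>. S' \<noteq> S \<longrightarrow> T \<notin> N S'" if S: "S \<in> \<D>" for S
    proof (rule ccontr)
      assume no_private: "\<not> ?thesis"
      have "N S \<subseteq> (\<Union>S'\<in>\<D> - {S}. N S')"
      proof
        fix T assume "T \<in> N S"
        with no_private obtain S' where "S' \<in> \<D>" "S' \<noteq> S" "T \<in> N S'" by blast
        then show "T \<in> (\<Union>S'\<in>\<D> - {S}. N S')" by blast
      qed
      then have "(\<Union>S'\<in>insert S (\<D> - {S}). N S') = (\<Union>S'\<in>\<D> - {S}. N S')"
        by (simp only: UN_insert Un_absorb1)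
      then have "\<D> - {S} \<in> ?K"
        using \<D> S by (auto simp: insert_absorb)
      from bspec[OF min this, THEN mp, OF Diff_subset] S show False by blast
    qed
  qed
qed

section \<open>Edge counts and \<open>ell\<close> under deletion of a member\<close>

definition disjoint_nbrs :: "'a set set \<Rightarrow> 'a set \<Rightarrow> 'a set set" where
  "disjoint_nbrs \<A> S = {T \<in> \<A>. S \<noteq> T \<and> S \<inter> T = {}}"

lemma num_disjoint_pairs_remove:
  assumes "finite \<A>" "S \<in> \<A>"
  shows "num_disjoint_pairs (\<A> - {S}) + card (disjoint_nbrs \<A> S) \<le> num_disjoint_pairs \<A>"
proof -
  let ?E = "(\<lambda>T. {S, T}) ` disjoint_nbrs \<A> S"
  have "disjoint_pairs \<A> \<subseteq> Pow \<A>" by (auto simp: disjoint_pairs_def)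
  then have fin: "finite (disjoint_pairs \<A>)" using assms(1) finite_subset by blast
  have sub: "disjoint_pairs (\<A> - {S}) \<union> ?E \<subseteq> disjoint_pairs \<A>"
    using assms(2) by (auto simp: disjoint_pairs_def disjoint_nbrs_def)
  have "card (disjoint_nbrs \<A> S) = card ?E"
    by (rule card_image[symmetric]) (auto simp: inj_on_def doubleton_eq_iff)
  moreover have "S \<notin> e" if "e \<in> disjoint_pairs (\<A> - {S})" for e
    using that by (auto simp: disjoint_pairs_def)
  then have "disjoint_pairs (\<A> - {S}) \<inter> ?E = {}" by blast
  ultimately have "card (disjoint_pairs (\<A> - {S}) \<union> ?E)
      = num_disjoint_pairs (\<A> - {S}) + card (disjoint_nbrs \<A> S)"
    using fin sub unfolding num_disjoint_pairs_def
    by (metis card_Un_disjoint finite_Un finite_subset)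
  then show ?thesis
    using card_mono[OF fin sub] by (simp add: num_disjoint_pairs_def)
qed

lemma finite_intersecting_cards:
  assumes "finite \<A>"
  shows "finite {card \<B> | \<B>. \<B> \<subseteq> \<A> \<and> intersecting \<B>}"
proof -
  have "{card \<B> | \<B>. \<B> \<subseteq> \<A> \<and> intersecting \<B>} \<subseteq> card ` Pow \<A>" by blast
  then show ?thesis using assms finite_subset by blast
qed

text \<open>With \<open>ell_attained\<close>, this recasts \<open>ell\<close> as the least number of
  members whose deletion leaves an intersecting family.\<close>

lemma ell_le:
  assumes "finite \<A>" "\<B> \<subseteq> \<A>" "intersecting \<B>"
  shows "ell \<A> \<le> card (\<A> - \<B>)"
proof -
  have "card \<B> \<le> Max {card \<B> | \<B>. \<B> \<subseteq> \<A> \<and> intersecting \<B>}"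
    using assms finite_intersecting_cards by (intro Max_ge) auto
  moreover have "card (\<A> - \<B>) = card \<A> - card \<B>"
    using assms finite_subset by (intro card_Diff_subset) auto
  ultimately show ?thesis by (simp add: ell_def)
qed

lemma ell_attained:
  assumes "finite \<A>"
  obtains \<B> where "\<B> \<subseteq> \<A>" "intersecting \<B>" "ell \<A> = card (\<A> - \<B>)"
proof -
  let ?M = "{card \<B> | \<B>. \<B> \<subseteq> \<A> \<and> intersecting \<B>}"
  have "intersecting {}" by (simp add: intersecting_def)
  then have "?M \<noteq> {}" by blast
  from Max_in[OF finite_intersecting_cards[OF assms] this]
  obtain \<B> where \<B>: "\<B> \<subseteq> \<A>" "intersecting \<B>" "Max ?M = card \<B>" by auto
  moreover have "card (\<A> - \<B>) = card \<A> - card \<B>"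
    using \<B> assms finite_subset by (intro card_Diff_subset) auto
  ultimately show thesis using that by (simp add: ell_def)
qed

text \<open>An optimal set of deletions for \<open>\<A> - {S}\<close>, enlarged by \<open>S\<close>,
  works for \<open>\<A>\<close>.\<close>

lemma ell_remove:
  assumes "finite \<A>"
  shows "ell \<A> \<le> Suc (ell (\<A> - {S}))"
proof -
  obtain \<B> where \<B>: "\<B> \<subseteq> \<A> - {S}" "intersecting \<B>" "ell (\<A> - {S}) = card (\<A> - {S} - \<B>)"
    using ell_attained[of "\<A> - {S}"] assms by blast
  then have "ell \<A> \<le> card (\<A> - \<B>)" using assms by (intro ell_le) auto
  also have "\<dots> \<le> card (insert S (\<A> - {S} - \<B>))"
    using assms by (intro card_mono) auto
  also have "\<dots> \<le> Suc (ell (\<A> - {S}))"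
    using \<B>(3) assms by (simp add: card_insert_if)
  finally show ?thesis .
qed

section \<open>A member of large degree, and iterated deletion\<close>

lemma ell_le_binomial_times_degree:
  assumes "finite X" "\<A> \<subseteq> nsets X r" "ell \<A> > 0"
  obtains S where "S \<in> \<A>" "ell \<A> \<le> ((2 * r) choose r) * card (disjoint_nbrs \<A> S)"
proof -
  let ?N = "disjoint_nbrs \<A>"
  have fin: "finite \<A>" using assms finite_imp_finite_nsets finite_subset by blast
  obtain \<D> where \<D>: "\<D> \<subseteq> \<A>" "(\<Union>S\<in>\<D>. ?N S) = (\<Union>S\<in>\<A>. ?N S)"
    and "\<And>S. S \<in> \<D> \<Longrightarrow> \<exists>T\<in>?N S. \<forall>S'\<in>\<D>. S' \<noteq> S \<longrightarrow> T \<notin> ?N S'"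
    by (rule minimal_subcover[OF fin, of ?N]) blast
  then obtain P where P: "\<And>S. S \<in> \<D> \<Longrightarrow> P S \<in> ?N S"
    and priv: "\<And>S S'. S \<in> \<D> \<Longrightarrow> S' \<in> \<D> \<Longrightarrow> S' \<noteq> S \<Longrightarrow> P S \<notin> ?N S'"
    by metis
  have finD: "finite \<D>" using \<D>(1) fin finite_subset by blast
  have "card \<D> \<le> (r + r) choose r"
  proof (rule Bollobas_uniform[where A = "\<lambda>S. S" and B = P and X = X])
    fix S S' assume S: "S \<in> \<D>" "S' \<in> \<D>" "S \<noteq> S'"
    \<comment> \<open>Two distinct \<open>r\<close>-sets exclude \<open>r = 0\<close>, hence
      \<open>S\<close> is nonempty.\<close>
    have "P S \<in> nsets X r" "S \<in> nsets X r" "S \<noteq> P S"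
      using P[OF S(1)] S(1) \<D>(1) assms(2) by (auto simp: disjoint_nbrs_def)
    then have "S \<noteq> {}" by (auto simp: nsets_def)
    \<comment> \<open>\<open>P S'\<close> is private to \<open>S'\<close>, so it is no neighbour of
      \<open>S\<close>: it meets \<open>S\<close> or equals \<open>S\<close>, and in the latter case
      the intersection is the nonempty \<open>S\<close>.\<close>
    then show "S \<inter> P S' \<noteq> {}"
      using priv[of S' S] P[OF S(2)] S by (auto simp: disjoint_nbrs_def)
  qed (use P \<D>(1) assms(1,2) finD in \<open>auto simp: disjoint_nbrs_def\<close>)
  then have cardD: "card \<D> \<le> (2 * r) choose r" by (simp add: mult_2)
  have "intersecting (\<A> - (\<Union>S\<in>\<A>. ?N S))"
    by (auto simp: intersecting_def pairwise_def disjoint_nbrs_def)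
  then have "ell \<A> \<le> card (\<A> - (\<A> - (\<Union>S\<in>\<A>. ?N S)))"
    using fin by (intro ell_le) auto
  also have "\<dots> \<le> card (\<Union>S\<in>\<D>. ?N S)"
    unfolding \<D>(2) using fin by (intro card_mono) (auto simp: disjoint_nbrs_def)
  also have "\<dots> \<le> (\<Sum>S\<in>\<D>. card (?N S))" using finD by (rule card_UN_le)
  finally have le_sum: "ell \<A> \<le> (\<Sum>S\<in>\<D>. card (?N S))" .
  \<comment> \<open>Averaging: a member of \<open>\<D>\<close> of maximum degree is the required
    one.\<close>
  then have "\<D> \<noteq> {}" using assms(3) by auto
  then have "Max ((\<lambda>S. card (?N S)) ` \<D>) \<in> (\<lambda>S. card (?N S)) ` \<D>"
    using finD by (intro Max_in) auto
  then obtain S where S: "S \<in> \<D>" and max: "Max ((\<lambda>S. card (?N S)) ` \<D>) = card (?N S)"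
    by blast
  have "card (?N S') \<le> card (?N S)" if "S' \<in> \<D>" for S'
    unfolding max[symmetric] using finD that by (intro Max_ge) auto
  then have "(\<Sum>S\<in>\<D>. card (?N S)) \<le> card \<D> * card (?N S)"
    using sum_bounded_above[of \<D> "\<lambda>S. card (?N S)"] by simp
  also have "\<dots> \<le> ((2 * r) choose r) * card (?N S)" using cardD by (rule mult_le_mono1)
  finally have "ell \<A> \<le> ((2 * r) choose r) * card (?N S)" using le_sum by simp
  with S \<D>(1) that show thesis by blast
qed

lemma ell_bound:
  assumes "finite X" "\<A> \<subseteq> nsets X r"
  shows "ell \<A> * (ell \<A> + 1) \<le> 2 * ((2 * r) choose r) * num_disjoint_pairs \<A>"
  using assms(2)
\<comment> \<open>Induction is on the size of the family, because deleting \<open>S\<close> need not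
  lower \<open>ell\<close>.\<close>
proof (induction "card \<A>" arbitrary: \<A> rule: less_induct)
  case less
  let ?C = "(2 * r) choose r"
  have fin: "finite \<A>" using assms(1) less.prems finite_imp_finite_nsets finite_subset by blast
  show ?case
  proof (cases "ell \<A>")
    case (Suc k)
    then obtain S where S: "S \<in> \<A>" and deg: "ell \<A> \<le> ?C * card (disjoint_nbrs \<A> S)"
      using ell_le_binomial_times_degree[OF assms(1) less.prems] by auto
    \<comment> \<open>Only a lower bound on the new \<open>ell\<close> is available; monotonicity of
      \<open>t * (t + 1)\<close> brings it back to \<open>k\<close>.\<close>
    have "k \<le> ell (\<A> - {S})" using ell_remove[OF fin, of S] Suc by simp
    then have "k * (k + 1) \<le> ell (\<A> - {S}) * (ell (\<A> - {S}) + 1)" by (intro mult_le_mono) auto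
    also have "\<dots> \<le> 2 * ?C * num_disjoint_pairs (\<A> - {S})"
      using less.prems card_Diff1_less[OF fin S] by (intro less.hyps) auto
    finally have "k * (k + 1) \<le> 2 * ?C * num_disjoint_pairs (\<A> - {S})" .
    \<comment> \<open>With \<open>ell \<A> = k + 1\<close> this rests on
      \<open>k * (k + 1) + 2 * (k + 1) = (k + 1) * (k + 2)\<close>.\<close>
    then have "ell \<A> * (ell \<A> + 1)
        \<le> 2 * ?C * (num_disjoint_pairs (\<A> - {S}) + card (disjoint_nbrs \<A> S))"
      using deg Suc by (simp add: algebra_simps)
    also have "\<dots> \<le> 2 * ?C * num_disjoint_pairs \<A>"
      using num_disjoint_pairs_remove[OF fin S] by (rule mult_le_mono2)
    finally show ?thesis .
  qed simp
qed

theorem lemma3p1: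
  fixes n r :: nat and \<A> :: "nat set set"
  assumes "\<A> \<subseteq> nsets {1..n} r"
  shows "real (num_disjoint_pairs \<A>) \<ge> (real (ell \<A>))\<^sup>2 / (2 * real ((2 * r) choose r))"
proof -
  have "(ell \<A>)\<^sup>2 \<le> 2 * ((2 * r) choose r) * num_disjoint_pairs \<A>"
    using ell_bound[OF _ assms] by (simp add: power2_eq_square)
  then have "(real (ell \<A>))\<^sup>2 \<le> 2 * real ((2 * r) choose r) * real (num_disjoint_pairs \<A>)"
    by (metis of_nat_le_iff of_nat_mult of_nat_numeral of_nat_power)
  moreover have "real ((2 * r) choose r) > 0" by simp
  ultimately show ?thesis by (simp add: field_simps)
qed

end
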